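(* Let $G$ be a Fuchsian group of the first kind with a cusp at $\infty$, and let $H$ be any finite index subgroup of $G$, with $[G:H]=m$. Fix any cusp $\mathfrak{c}$ in a set of representatives of the $G$-inequivalent cusps, and let $\mathfrak{c}_1,\ldots,\mathfrak{c}_{n_{\mathfrak{c}}}$ be the representatives of the $H$-inequivalent cusps which are $G$-equivalent to $\mathfrak{c}$, so that $G\cdot\mathfrak{c}=\bigcup_{i=1}^{n_{\mathfrak{c}}}H\cdot\mathfrak{c}_i$. Let $k_{\mathfrak{c}}$ be the cusp width of $\mathfrak{c}$ in $G$ and let $h_{\mathfrak{c}_i}$ be the cusp width of $\mathfrak{c}_i$ in $H$. Write $h_i=h_{\mathfrak{c}_i}/k_{\mathfrak{c}}\in\mathbb{Z}$, $G_{\mathfrak{c}}=\langle t_{\mathfrak{c}}\rangle$, and $A_i(\mathfrak{c})=\mathfrak{c}_i$ where $A_i\in G$. Then $m=\sum_i h_i$, and coset representatives of $H$ in $G$ can be taken to be $g_{ij}=t_{\mathfrak{c}}^{\,j}A_i^{-1}$ for all $i$ and $0\le j<h_i$.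
   Context: $\mathrm{PSL}_2(\mathbb{R})$ acts by Möbius transformations on the upper half plane $\mathbb{H}$ and on $\mathbb{R}\cup\{\infty\}$. A Fuchsian group of the first kind is a discrete subgroup of $\mathrm{PSL}_2(\mathbb{R})$ having a fundamental domain in $\mathbb{H}$ of finite hyperbolic area. A cusp of the group is a point of $\mathbb{R}\cup\{\infty\}$ fixed by one of its nontrivial parabolic elements. Cusp width: let $\Gamma$ be $G$ or $H$ and write $t^{h}=\pm\begin{pmatrix}1&h\\0&1\end{pmatrix}$. The stabilizer $\Gamma_\infty$ of the cusp $\infty$ is infinite cyclic, generated by $t^{h}$ for a unique positive real number $h$, the cusp width of $\infty$ in $\Gamma$. For a cusp $\mathfrak{c}\in\mathbb{R}$ put $A_{\mathfrak{c}}=\pm\begin{pmatrix}\mathfrak{c}&-1\\1&0\end{pmatrix}$, so $A_{\mathfrak{c}}(\infty)=\mathfrak{c}$; the stabilizer $\Gamma_{\mathfrak{c}}$ is infinite cyclic, generated by $A_{\mathfrak{c}}t^{h}A_{\mathfrak{c}}^{-1}$, where the cusp width $h$ of $\mathfrak{c}$ in $\Gamma$ is the smallest positive real number for which this element lies in $\Gamma$. In particular $t_{\mathfrak{c}}=A_{\mathfrak{c}}t^{k_{\mathfrak{c}}}A_{\mathfrak{c}}^{-1}$ (with $A_\infty=I$) generates $G_{\mathfrak{c}}$. Cosets are the cosets $gH$ with $g\in G$.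
   Formalization: With the stated widths h_i = h_{c_i}/k_c fails (G=H=PSL_2(Z), c=∞, c_1=1/2 gives 4, but m=1); instead h_i is the width of c_i in H divided by the width of c_i in G, shown equal to (H-width of c_i measured via A_i A_c)/k_c. *)

theory Defs
  imports "HOL-Analysis.Analysis" "HOL-Algebra.Left_Coset" "HOL-Algebra.Group_Action"
    "HOL-Algebra.Generated_Groups"
begin

section \<open>The group PSL(2,R)\<close>

definition SL2R :: "(real^2^2) monoid" where
  "SL2R = \<lparr>carrier = {A. det A = 1}, mult = (**), one = mat 1\<rparr>"

text \<open>The elements of the quotient are the two-element sets consisting of \<open>A\<close> and \<open>- A\<close>.\<close>

definition PSL2R :: "(real^2^2) set monoid" where
  "PSL2R = SL2R Mod {mat 1, - mat 1}"

definition mat2 :: "real \<Rightarrow> real \<Rightarrow> real \<Rightarrow> real \<Rightarrow> real^2^2" where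
  "mat2 a b c d = vector [vector [a, b], vector [c, d]]"

definition pm :: "real^2^2 \<Rightarrow> (real^2^2) set" where
  "pm A = {A, - A}"

lemma carrier_PSL2R: "carrier PSL2R = pm ` {A. det A = 1}"
proof -
  have neg: "(- A) ** B = - (A ** B)" for A B :: "real^2^2"
    by (simp add: matrix_matrix_mult_def vec_eq_iff sum_negf)
  have coset: "{mat 1, - mat 1} #>\<^bsub>SL2R\<^esub> A = pm A" for A
    by (simp only: r_coset_def SL2R_def pm_def neg UN_insert UN_empty monoid.simps
        matrix_mul_lid Un_empty_right insert_is_Un[symmetric])
  have car: "carrier SL2R = {A. det A = 1}"
    by (simp add: SL2R_def)
  show ?thesis
    by (auto simp: PSL2R_def FactGroup_def RCOSETS_def coset car)
qed

text \<open>The topology of \<open>PSL2R\<close> is the quotient topology: a set \<open>U\<close> of classes is open iff its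
  preimage \<open>\<Union>U\<close> under the projection from \<open>SL2R\<close> is open in \<open>SL2R\<close>.\<close>

definition PSL2R_topology :: "(real^2^2) set topology" where
  "PSL2R_topology = topology (\<lambda>U. U \<subseteq> carrier PSL2R \<and>
     openin (top_of_set (carrier SL2R)) (\<Union>U))"

lemma istopology_PSL2R:
  "istopology (\<lambda>U. U \<subseteq> carrier PSL2R \<and> openin (top_of_set (carrier SL2R)) (\<Union>U))"
proof -
  have pm: "pm B = pm a" if "a \<in> pm B" for a B
    using that unfolding pm_def by force
  have eq: "X = Y" if "X \<in> carrier PSL2R" "Y \<in> carrier PSL2R" "a \<in> X" "a \<in> Y" for X Y a
    using that pm unfolding carrier_PSL2R by blast
  have Int: "\<Union>(S \<inter> T) = \<Union>S \<inter> \<Union>T" if "S \<subseteq> carrier PSL2R" "T \<subseteq> carrier PSL2R" for S T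
    using that eq by blast
  have Un: "\<Union>(\<Union>K) = \<Union>(Union ` K)" for K :: "'a set set set"
    by blast
  show ?thesis
    unfolding istopology_def
  proof (intro conjI allI impI; (elim conjE)?)
    fix S T
    assume "S \<subseteq> carrier PSL2R" "openin (top_of_set (carrier SL2R)) (\<Union>S)"
      and "T \<subseteq> carrier PSL2R" "openin (top_of_set (carrier SL2R)) (\<Union>T)"
    then show "openin (top_of_set (carrier SL2R)) (\<Union>(S \<inter> T))"
      by (simp only: Int openin_Int)
  next
    fix K
    assume "\<forall>S\<in>K. S \<subseteq> carrier PSL2R \<and> openin (top_of_set (carrier SL2R)) (\<Union>S)"
    then show "openin (top_of_set (carrier SL2R)) (\<Union>(\<Union>K))"
      unfolding Un by (intro openin_Union) blast
  qed blast+
qed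

section \<open>Moebius action\<close>

definition upper_half_plane :: "complex set" where
  "upper_half_plane = {z. Im z > 0}"

datatype boundary_point = Pt real | Infty

definition mobius :: "real^2^2 \<Rightarrow> complex \<Rightarrow> complex" where
  "mobius A z = (complex_of_real (A$1$1) * z + complex_of_real (A$1$2)) /
                (complex_of_real (A$2$1) * z + complex_of_real (A$2$2))"

fun mobius_bd :: "real^2^2 \<Rightarrow> boundary_point \<Rightarrow> boundary_point" where
  "mobius_bd A Infty = (if A$2$1 = 0 then Infty else Pt (A$1$1 / A$2$1))"
| "mobius_bd A (Pt x) = (if A$2$1 * x + A$2$2 = 0 then Infty
     else Pt ((A$1$1 * x + A$1$2) / (A$2$1 * x + A$2$2)))"

text \<open>\<open>A\<close> and \<open>- A\<close> act in the same way, so the images below are singletons.\<close>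

definition act :: "(real^2^2) set \<Rightarrow> complex \<Rightarrow> complex" where
  "act X z = the_elem ((\<lambda>A. mobius A z) ` X)"

definition act_bd :: "(real^2^2) set \<Rightarrow> boundary_point \<Rightarrow> boundary_point" where
  "act_bd X p = the_elem ((\<lambda>A. mobius_bd A p) ` X)"

abbreviation orbit_bd :: "(real^2^2) set set \<Rightarrow> boundary_point \<Rightarrow> boundary_point set" where
  "orbit_bd \<Gamma> p \<equiv> orbit (PSL2R\<lparr>carrier := \<Gamma>\<rparr>) act_bd p"

abbreviation stabilizer_bd :: "(real^2^2) set set \<Rightarrow> boundary_point \<Rightarrow> (real^2^2) set set" where
  "stabilizer_bd \<Gamma> p \<equiv> stabilizer (PSL2R\<lparr>carrier := \<Gamma>\<rparr>) act_bd p"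

section \<open>Fuchsian groups of the first kind and their cusps\<close>

definition hyperbolic_area :: "complex set \<Rightarrow> ennreal" where
  "hyperbolic_area S = (\<integral>\<^sup>+z\<in>S. ennreal (1 / (Im z)\<^sup>2) \<partial>lborel)"

text \<open>Beardon's definition of a fundamental domain. The null boundary condition matters: without it,
  dense open sets of small area would be fundamental domains of the trivial group.\<close>

definition fundamental_domain :: "(real^2^2) set set \<Rightarrow> complex set \<Rightarrow> bool" where
  "fundamental_domain \<Gamma> D \<longleftrightarrow>
     D \<noteq> {} \<and> D \<subseteq> upper_half_plane \<and> open D \<and> connected D \<and>
     (\<forall>z\<in>D. \<forall>w\<in>D. \<forall>X\<in>\<Gamma>. act X z = w \<longrightarrow> z = w) \<and>
     (\<forall>z\<in>upper_half_plane. \<exists>X\<in>\<Gamma>. act X z \<in> closure D) \<and>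
     hyperbolic_area (frontier D \<inter> upper_half_plane) = 0"

definition fuchsian_first_kind :: "(real^2^2) set set \<Rightarrow> bool" where
  "fuchsian_first_kind \<Gamma> \<longleftrightarrow>
     subgroup \<Gamma> PSL2R \<and>
     subtopology PSL2R_topology \<Gamma> = discrete_topology \<Gamma> \<and>
     (\<exists>D. fundamental_domain \<Gamma> D \<and> hyperbolic_area D < \<infinity>)"

definition parabolic :: "(real^2^2) set \<Rightarrow> bool" where
  "parabolic X \<longleftrightarrow> X \<in> carrier PSL2R \<and> X \<noteq> \<one>\<^bsub>PSL2R\<^esub> \<and> (\<forall>A\<in>X. \<bar>trace A\<bar> = 2)"

definition is_cusp :: "(real^2^2) set set \<Rightarrow> boundary_point \<Rightarrow> bool" where
  "is_cusp \<Gamma> p \<longleftrightarrow> (\<exists>X\<in>\<Gamma>. parabolic X \<and> act_bd X p = p)"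

section \<open>Cusp widths\<close>

definition transl :: "real \<Rightarrow> (real^2^2) set" where
  "transl h = pm (mat2 1 h 0 1)"

fun cusp_mat :: "boundary_point \<Rightarrow> (real^2^2) set" where
  "cusp_mat Infty = \<one>\<^bsub>PSL2R\<^esub>"
| "cusp_mat (Pt x) = pm (mat2 x (-1) 1 0)"

definition conj_transl :: "(real^2^2) set \<Rightarrow> real \<Rightarrow> (real^2^2) set" where
  "conj_transl B h = B \<otimes>\<^bsub>PSL2R\<^esub> transl h \<otimes>\<^bsub>PSL2R\<^esub> inv\<^bsub>PSL2R\<^esub> B"

text \<open>Width of the cusp \<open>B \<infinity>\<close>, measured in the coordinate given by \<open>B\<close>.\<close>

definition width_wrt :: "(real^2^2) set set \<Rightarrow> (real^2^2) set \<Rightarrow> real" where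
  "width_wrt \<Gamma> B = (LEAST h. 0 < h \<and> conj_transl B h \<in> \<Gamma>)"

text \<open>This number depends on the cusp itself, not only on its orbit: in the modular group
  \<open>Infty\<close> has width 1, but \<open>Pt (1/2)\<close> has width 4. So widths in a group and in a subgroup may only
  be compared at the same cusp, or in coordinates that correspond under the group.\<close>

definition cusp_width :: "(real^2^2) set set \<Rightarrow> boundary_point \<Rightarrow> real" where
  "cusp_width \<Gamma> p = width_wrt \<Gamma> (cusp_mat p)"

definition cusp_gen :: "(real^2^2) set set \<Rightarrow> boundary_point \<Rightarrow> (real^2^2) set" where
  "cusp_gen \<Gamma> p = conj_transl (cusp_mat p) (cusp_width \<Gamma> p)"

end

theory Submission
  imports Defs
begin

text \<open>
  The cosets \<open>gH\<close> correspond to the cosets \<open>Hg\<^sup>-\<^sup>1\<close>, and the group \<open>G\<^sub>\<cc> = \<langle>t\<rangle>\<close> permutes them.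
  Its orbits are the double cosets \<open>H g G\<^sub>\<cc>\<close>, which are the \<open>H\<close>-orbits on \<open>G \<cdot> \<cc> = G / G\<^sub>\<cc>\<close>.
  Every point of \<open>G \<cdot> \<cc>\<close> is a cusp of \<open>H\<close>, because a power of a parabolic element of \<open>G\<close> lies in the
  finite index subgroup \<open>H\<close> (\<open>is_cusp_finite_index\<close>). So the given representatives of cusps
  cover all \<open>H\<close>-orbits on \<open>G \<cdot> \<cc>\<close>, and \<open>G\<close> is the disjoint union of the \<open>H A\<^sub>i \<langle>t\<rangle>\<close>. The \<open>i\<close>-th of them
  contains as many cosets as the index of \<open>H \<inter> A\<^sub>i \<langle>t\<rangle> A\<^sub>i\<^sup>-\<^sup>1\<close> in
  \<open>A\<^sub>i \<langle>t\<rangle> A\<^sub>i\<^sup>-\<^sup>1\<close>, that is, the least \<open>d > 0\<close> with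
  \<open>A\<^sub>i t\<^sup>d A\<^sub>i\<^sup>-\<^sup>1 \<in> H\<close>; the powers \<open>t\<^sup>j\<close> with \<open>0 \<le> j < d\<close> separate them. This
  counting is pure group theory (\<open>lcosets_of_cyclic_double_cosets\<close>).

  The geometric part identifies \<open>t\<close> and \<open>d\<close>. For a coordinate \<open>B\<close> with \<open>B \<infinity> = p\<close>, the reals \<open>x\<close> for which
  \<open>B t\<^sup>x B\<^sup>-\<^sup>1\<close> lies in a discrete group form a discrete subgroup of the line, which is
  nonzero exactly when \<open>p\<close> is a cusp, and so consists of the multiples of the width
  (\<open>periods_eq_width_multiples\<close>). Two coordinates at the same cusp differ by
  \<open>z \<mapsto> a\<^sup>2 z + a b\<close>, which divides every width by \<open>a\<^sup>2\<close>. This has two consequences. An element of the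
  stabilizer of a cusp does not change the width, so \<open>a\<^sup>2 = 1\<close> and it is a translation in the coordinate
  \<open>B\<close> (\<open>stabilizer_consists_of_translations\<close>). And the ratio of the widths in \<open>H\<close>
  and \<open>G\<close> is the same in all coordinates (\<open>width_ratio_coordinate_free\<close>), so that \<open>h\<^sub>i\<close> may be computed
  in the coordinate \<open>A\<^sub>i B\<close> transported from \<open>\<cc>\<close>, where the width in \<open>G\<close> is still that of \<open>\<cc>\<close>
  and the ratio is visibly \<open>d\<close>.
\<close>

section \<open>PSL(2,R) and its action on the boundary\<close>

lemma (in group) inv_mult_cancel [simp]:
  assumes "x \<in> carrier G" "y \<in> carrier G"
  shows "inv x \<otimes> (x \<otimes> y) = y" "x \<otimes> (inv x \<otimes> y) = y"
  using assms by (simp_all flip: m_assoc)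

lemma (in group) conj_eq_one_iff:
  assumes "x \<in> carrier G" "y \<in> carrier G"
  shows "x \<otimes> y \<otimes> inv x = \<one> \<longleftrightarrow> y = \<one>"
proof
  assume "x \<otimes> y \<otimes> inv x = \<one>"
  then have "inv x \<otimes> (x \<otimes> y \<otimes> inv x) \<otimes> x = \<one>"
    using assms by simp
  with assms show "y = \<one>" by (simp add: m_assoc)
qed (use assms in simp)

lemma mat2_nth [simp]:
  "mat2 a b c d $ 1 $ 1 = a" "mat2 a b c d $ 1 $ 2 = b"
  "mat2 a b c d $ 2 $ 1 = c" "mat2 a b c d $ 2 $ 2 = d"
  by (simp_all add: mat2_def)

lemma det_mat2 [simp]: "det (mat2 a b c d) = a * d - b * c"
  by (simp add: det_2)

lemma mat2_entries: "mat2 (A$1$1) (A$1$2) (A$2$1) (A$2$2) = A"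
  by (simp add: vec_eq_iff forall_2)

lemma mat2_mult [simp]:
  "mat2 a b c d ** mat2 a' b' c' d' = mat2 (a*a' + b*c') (a*b' + b*d') (c*a' + d*c') (c*b' + d*d')"
  by (simp add: matrix_matrix_mult_def vec_eq_iff forall_2 sum_2)

lemma mat_1_eq_mat2: "mat 1 = mat2 1 0 0 1"
  by (simp add: vec_eq_iff forall_2 mat_def)

lemma pm_minus [simp]: "pm (- A) = pm A"
  by (auto simp: pm_def)

lemma pm_eq_iff: "pm A = pm B \<longleftrightarrow> A = B \<or> A = - B"
  by (auto simp: pm_def doubleton_eq_iff)

lemma matrix_mult_minus:
  fixes A :: "real^'n^'m" and B :: "real^'p^'n"
  shows "(- A) ** B = - (A ** B)" "A ** (- B) = - (A ** B)"
  by (simp_all add: matrix_matrix_mult_def vec_eq_iff sum_negf)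

lemma group_SL2R: "group SL2R"
proof (rule groupI)
  fix A assume "A \<in> carrier SL2R"
  then have A: "det A = 1"
    by (simp add: SL2R_def)
  then obtain B where "A ** B = mat 1" and B: "B ** A = mat 1"
    using invertible_det_nz[of A] by (auto simp: invertible_def)
  then have "det B = 1"
    using A det_mul[of B A] by simp
  with B show "\<exists>B\<in>carrier SL2R. B \<otimes>\<^bsub>SL2R\<^esub> A = \<one>\<^bsub>SL2R\<^esub>"
    by (auto simp: SL2R_def)
qed (auto simp: SL2R_def det_mul matrix_mul_assoc)

lemma det_minus2 [simp]: "det (- A) = det (A :: real^2^2)"
  by (simp add: det_2)

lemma center_normal_SL2R: "{mat 1, - mat 1} \<lhd> SL2R"
proof -
  interpret group SL2R by (rule group_SL2R)
  have "subgroup {mat 1, - mat 1} SL2R"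
  proof (rule subgroupI)
    fix A assume A: "A \<in> {mat 1, - mat 1 :: real^2^2}"
    then have "A \<otimes>\<^bsub>SL2R\<^esub> A = \<one>\<^bsub>SL2R\<^esub>" "A \<in> carrier SL2R"
      by (auto simp: SL2R_def matrix_mult_minus)
    then have "inv\<^bsub>SL2R\<^esub> A = A"
      by (metis inv_equality)
    with A show "inv\<^bsub>SL2R\<^esub> A \<in> {mat 1, - mat 1}"
      by simp
  qed (auto simp: SL2R_def matrix_mult_minus)
  moreover have "A \<otimes>\<^bsub>SL2R\<^esub> B \<otimes>\<^bsub>SL2R\<^esub> inv\<^bsub>SL2R\<^esub> A \<in> {mat 1, - mat 1}"
    if A: "A \<in> carrier SL2R" and B: "B \<in> {mat 1, - mat 1}" for A B
  proof -
    have "A ** inv\<^bsub>SL2R\<^esub> A = mat 1"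
      using r_inv[OF A] by (simp add: SL2R_def)
    with B show ?thesis
      by (auto simp: SL2R_def matrix_mult_minus)
  qed
  ultimately show ?thesis
    by (simp add: normal_inv_iff)
qed

lemma group_PSL2R: "group PSL2R"
  unfolding PSL2R_def by (rule normal.factorgroup_is_group[OF center_normal_SL2R])

interpretation PSL2R: group PSL2R
  by (rule group_PSL2R)

lemma pm_in_PSL2R [simp]: "pm A \<in> carrier PSL2R \<longleftrightarrow> det A = 1"
  unfolding carrier_PSL2R by (auto simp: pm_eq_iff)

lemma PSL2R_cases:
  assumes "X \<in> carrier PSL2R"
  obtains a b c d where "X = pm (mat2 a b c d)" "a * d - b * c = 1"
proof -
  obtain A where "X = pm A" "det A = 1"
    using assms by (auto simp: carrier_PSL2R)
  then show thesis
    using that[of "A$1$1" "A$1$2" "A$2$1" "A$2$2"] by (simp add: mat2_entries det_2)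
qed

lemma pm_mult [simp]: "pm A \<otimes>\<^bsub>PSL2R\<^esub> pm B = pm (A ** B)"
  by (auto simp: PSL2R_def FactGroup_def set_mult_def SL2R_def pm_def matrix_mult_minus)

lemma one_PSL2R: "\<one>\<^bsub>PSL2R\<^esub> = pm (mat2 1 0 0 1)"
  by (auto simp: PSL2R_def FactGroup_def pm_def mat_1_eq_mat2)

lemma inv_PSL2R [simp]:
  assumes "a * d - b * c = 1"
  shows "inv\<^bsub>PSL2R\<^esub> pm (mat2 a b c d) = pm (mat2 d (-b) (-c) a)"
  using assms by (intro PSL2R.inv_equality) (auto simp: one_PSL2R algebra_simps)

lemma act_bd_pm [simp]: "act_bd (pm A) p = mobius_bd A p"
proof -
  have "mobius_bd (- A) p = mobius_bd A p"
    by (cases p) (auto simp: divide_simps algebra_simps add_eq_0_iff)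
  then show ?thesis
    by (simp add: act_bd_def pm_def)
qed

lemma act_bd_mult:
  assumes "X \<in> carrier PSL2R" "Y \<in> carrier PSL2R"
  shows "act_bd (X \<otimes>\<^bsub>PSL2R\<^esub> Y) p = act_bd X (act_bd Y p)"
proof -
  obtain a b c d where X: "X = pm (mat2 a b c d)" "a * d - b * c = 1"
    using PSL2R_cases[OF assms(1)] .
  obtain a' b' c' d' where Y: "Y = pm (mat2 a' b' c' d')" "a' * d' - b' * c' = 1"
    using PSL2R_cases[OF assms(2)] .
  show ?thesis
  proof (cases p)
    case Infty
    show ?thesis
    proof (cases "c' = 0")
      case True
      then have "a' \<noteq> 0" using Y by auto
      with True show ?thesis by (simp add: X Y Infty)
    next
      case False
      then have "c * a' + d * c' = (c * (a' / c') + d) * c'" "a * a' + b * c' = (a * (a' / c') + b) * c'"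
        by (simp_all add: field_simps)
      with False show ?thesis by (simp add: X Y Infty)
    qed
  next
    case (Pt x)
    let ?u = "a' * x + b'" and ?v = "c' * x + d'"
    have e: "(a * a' + b * c') * x + (a * b' + b * d') = a * ?u + b * ?v"
      "(c * a' + d * c') * x + (c * b' + d * d') = c * ?u + d * ?v"
      by (simp_all add: algebra_simps)
    show ?thesis
    proof (cases "?v = 0")
      case True
      have "?u \<noteq> 0"
      proof
        assume "?u = 0"
        have "a' * ?v - c' * ?u = a' * d' - b' * c'" by (simp add: algebra_simps)
        with True \<open>?u = 0\<close> Y show False by simp
      qed
      with True show ?thesis by (simp add: X Y Pt e)
    next
      case False
      then have "a * ?u + b * ?v = (a * (?u / ?v) + b) * ?v" "c * ?u + d * ?v = (c * (?u / ?v) + d) * ?v"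
        by (simp_all add: distrib_right)
      then show ?thesis using False by (simp add: X Y Pt e)
    qed
  qed
qed

lemma act_bd_one [simp]: "act_bd \<one>\<^bsub>PSL2R\<^esub> p = p"
  by (cases p) (simp_all add: one_PSL2R)

lemma act_bd_inv:
  assumes "X \<in> carrier PSL2R" "act_bd X p = q"
  shows "act_bd (inv\<^bsub>PSL2R\<^esub> X) q = p"
  using assms act_bd_mult[of "inv\<^bsub>PSL2R\<^esub> X" X p] by simp

lemma cusp_mat_closed [simp]: "cusp_mat p \<in> carrier PSL2R"
  by (cases p) simp_all

lemma act_cusp_mat [simp]: "act_bd (cusp_mat p) Infty = p"
  by (cases p) simp_all

section \<open>Translations and parabolic elements\<close>

lemma transl_closed [simp]: "transl x \<in> carrier PSL2R"
  by (simp add: transl_def)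

lemma transl_add: "transl (x + y) = transl x \<otimes>\<^bsub>PSL2R\<^esub> transl y"
  by (simp add: transl_def add.commute)

lemma transl_0 [simp]: "transl 0 = \<one>\<^bsub>PSL2R\<^esub>"
  by (simp add: transl_def one_PSL2R)

lemma mat2_eq_iff: "mat2 a b c d = mat2 a' b' c' d' \<longleftrightarrow> a = a' \<and> b = b' \<and> c = c' \<and> d = d'"
  by (metis mat2_nth)

lemma uminus_mat2: "- mat2 a b c d = mat2 (-a) (-b) (-c) (-d)"
  by (simp add: vec_eq_iff forall_2)

lemma transl_inject [simp]: "transl x = transl y \<longleftrightarrow> x = y"
  by (auto simp: transl_def pm_eq_iff uminus_mat2 mat2_eq_iff)

lemma fixes_Infty_cases:
  assumes "X \<in> carrier PSL2R" "act_bd X Infty = Infty"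
  obtains a b where "a \<noteq> 0" "X = pm (mat2 a b 0 (1 / a))"
proof -
  obtain a b c d where X: "X = pm (mat2 a b c d)" "a * d - b * c = 1"
    using PSL2R_cases[OF assms(1)] .
  with assms(2) have "c = 0"
    by (simp split: if_splits)
  with X have "a * d = 1"
    by simp
  then have "a \<noteq> 0" "d = 1 / a"
    by (auto simp: eq_divide_eq mult.commute)
  with X \<open>c = 0\<close> that show thesis
    by blast
qed

text \<open>The element fixing infinity acts as \<open>z \<mapsto> a\<^sup>2 z + a b\<close>; the factor \<open>a\<^sup>2\<close> by which it
  stretches translations is the source of all changes of width below.\<close>

lemma conj_transl_fixing_Infty:
  assumes "a \<noteq> 0"
  shows "conj_transl (pm (mat2 a b 0 (1 / a))) x = transl (a\<^sup>2 * x)"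
  using assms by (simp add: conj_transl_def transl_def power2_eq_square algebra_simps)

lemma transl_if_square_eq_1:
  assumes "a\<^sup>2 = 1"
  obtains y where "pm (mat2 a b 0 (1 / a)) = transl y"
proof -
  have "a = 1 \<or> a = -1"
    using assms by (simp add: power2_eq_1_iff)
  then show thesis
  proof
    assume "a = 1" then show thesis using that[of b] by (simp add: transl_def)
  next
    assume "a = -1"
    then have "pm (mat2 a b 0 (1 / a)) = pm (- mat2 1 (-b) 0 1)"
      by (simp add: uminus_mat2)
    then show thesis using that[of "-b"] by (simp add: transl_def)
  qed
qed

text \<open>The identity \<open>(a - 1/a)\<^sup>2 = (a + 1/a)\<^sup>2 - 4\<close> turns the condition on the trace into \<open>a = 1/a\<close>.\<close>

lemma parabolic_fixing_Infty:
  assumes "parabolic X" "act_bd X Infty = Infty"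
  obtains y where "y \<noteq> 0" "X = transl y"
proof -
  have X: "X \<in> carrier PSL2R" "X \<noteq> \<one>\<^bsub>PSL2R\<^esub>"
    using assms(1) by (simp_all add: parabolic_def)
  obtain a b where a: "a \<noteq> 0" "X = pm (mat2 a b 0 (1 / a))"
    using fixes_Infty_cases[OF X(1) assms(2)] .
  have "\<bar>a + 1 / a\<bar> = 2"
    using assms(1) a by (simp add: parabolic_def pm_def trace_def sum_2)
  then have "(a + 1 / a)\<^sup>2 = 4"
    by (metis power2_abs power2_eq_square mult_2 numeral_Bit0)
  have "(a - 1 / a)\<^sup>2 = (a + 1 / a)\<^sup>2 - 4"
    using a(1) by (simp add: power2_eq_square field_simps)
  then have "a = 1 / a"
    using \<open>(a + 1 / a)\<^sup>2 = 4\<close> by simp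
  then have "a\<^sup>2 = 1"
    using a(1) by (metis nonzero_eq_divide_eq power2_eq_square)
  then obtain y where "X = transl y"
    using transl_if_square_eq_1 a(2) by metis
  with X(2) that show thesis
    by (metis transl_0)
qed

lemma parabolic_transl: "y \<noteq> 0 \<Longrightarrow> parabolic (transl y)"
  unfolding parabolic_def
proof (intro conjI)
  assume "y \<noteq> 0"
  then show "transl y \<noteq> \<one>\<^bsub>PSL2R\<^esub>"
    by (metis transl_0 transl_inject)
  show "\<forall>A\<in>transl y. \<bar>trace A\<bar> = 2"
    by (auto simp: transl_def pm_def trace_def sum_2)
qed simp

lemma parabolic_conj:
  assumes "parabolic X" and Y: "Y \<in> carrier PSL2R"
  shows "parabolic (Y \<otimes>\<^bsub>PSL2R\<^esub> X \<otimes>\<^bsub>PSL2R\<^esub> inv\<^bsub>PSL2R\<^esub> Y)"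
proof -
  have X: "X \<in> carrier PSL2R" "X \<noteq> \<one>\<^bsub>PSL2R\<^esub>"
    using assms(1) by (simp_all add: parabolic_def)
  obtain a b c d where x: "X = pm (mat2 a b c d)" "a * d - b * c = 1"
    using PSL2R_cases[OF X(1)] .
  obtain a' b' c' d' where y: "Y = pm (mat2 a' b' c' d')" "a' * d' - b' * c' = 1"
    using PSL2R_cases[OF Y] .
  have "\<bar>a + d\<bar> = 2"
    using assms(1) by (simp add: x parabolic_def pm_def trace_def sum_2)
  moreover have "trace (mat2 a' b' c' d' ** mat2 a b c d ** mat2 d' (-b') (-c') a') =
      (a + d) * (a' * d' - b' * c')"
    by (simp add: trace_def sum_2 algebra_simps)
  ultimately have "\<bar>trace (mat2 a' b' c' d' ** mat2 a b c d ** mat2 d' (-b') (-c') a')\<bar> = 2"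
    using y by simp
  then have "\<forall>A\<in>Y \<otimes>\<^bsub>PSL2R\<^esub> X \<otimes>\<^bsub>PSL2R\<^esub> inv\<^bsub>PSL2R\<^esub> Y. \<bar>trace A\<bar> = 2"
    using y(2) unfolding x(1) y(1) inv_PSL2R[OF y(2)] pm_mult
    by (auto simp: pm_def trace_def sum_2)
  moreover have "Y \<otimes>\<^bsub>PSL2R\<^esub> X \<otimes>\<^bsub>PSL2R\<^esub> inv\<^bsub>PSL2R\<^esub> Y \<noteq> \<one>\<^bsub>PSL2R\<^esub>"
    using X Y by (simp add: PSL2R.conj_eq_one_iff)
  ultimately show ?thesis
    using X Y by (simp add: parabolic_def)
qed

section \<open>Widths of the cusps of discrete groups\<close>

text \<open>The infimum \<open>w\<close> of the positive elements is attained: two distinct elements in \<open>[w, w + \<epsilon>)\<close>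
  would differ by a nonzero element below \<open>\<epsilon>\<close>. Division with remainder by \<open>w\<close> does the rest.\<close>

lemma real_discrete_subgroup_cyclic:
  fixes S :: "real set"
  assumes diff: "\<And>x y. x \<in> S \<Longrightarrow> y \<in> S \<Longrightarrow> x - y \<in> S"
    and "\<epsilon> > 0" and gap: "\<And>x. x \<in> S \<Longrightarrow> \<bar>x\<bar> < \<epsilon> \<Longrightarrow> x = 0"
    and "s \<in> S" "s \<noteq> 0"
  obtains w where "w > 0" "S = range (\<lambda>k::int. of_int k * w)"
proof -
  have "0 \<in> S"
    using diff[OF \<open>s \<in> S\<close> \<open>s \<in> S\<close>] by simp
  have neg: "- x \<in> S" if "x \<in> S" for x
    using diff[OF \<open>0 \<in> S\<close> that] by simp
  have add: "x + y \<in> S" if "x \<in> S" "y \<in> S" for x y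
    using diff[OF that(1) neg[OF that(2)]] by simp
  define w where "w = Inf (S \<inter> {0<..})"
  have ne: "S \<inter> {0<..} \<noteq> {}"
  proof -
    have "\<bar>s\<bar> \<in> S" "\<bar>s\<bar> > 0"
      using \<open>s \<in> S\<close> \<open>s \<noteq> 0\<close> neg by (auto simp: abs_if)
    then show ?thesis by auto
  qed
  have bdd: "bdd_below (S \<inter> {0<..})"
    by (rule bdd_belowI[of _ 0]) auto
  have w_le: "w \<le> x" if "x \<in> S" "x > 0" for x
    unfolding w_def using that bdd by (intro cInf_lower) auto
  obtain x where x: "x \<in> S" "x > 0" "x < w + \<epsilon>"
    using cInf_lessD[OF ne, of "w + \<epsilon>"] \<open>\<epsilon> > 0\<close> unfolding w_def by auto
  have "w = x"
  proof (rule ccontr)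
    assume "w \<noteq> x"
    with w_le x have "w < x" by force
    then obtain y where y: "y \<in> S" "y > 0" "y < x"
      using cInf_lessD[OF ne, of x] unfolding w_def by auto
    have "\<bar>x - y\<bar> < \<epsilon>"
      using w_le[OF y(1,2)] x y by linarith
    with gap[OF diff[OF x(1) y(1)]] y(3) show False by simp
  qed
  with x have w: "w \<in> S" "w > 0" by simp_all
  have nat: "of_nat n * w \<in> S" for n
    by (induction n) (use \<open>0 \<in> S\<close> add w in \<open>auto simp: distrib_right\<close>)
  have int: "of_int k * w \<in> S" for k
    using nat neg by (cases k rule: int_cases2) force+
  have "y \<in> range (\<lambda>k::int. of_int k * w)" if "y \<in> S" for y
  proof -
    let ?r = "y - of_int \<lfloor>y / w\<rfloor> * w"
    have "?r = w * frac (y / w)"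
      using w(2) by (simp add: frac_def field_simps)
    then have "0 \<le> ?r" "?r < w"
      using w(2) frac_lt_1[of "y / w"] by simp_all
    moreover have "?r \<in> S"
      using diff[OF that int] .
    ultimately have "?r = 0"
      using w_le[of ?r] by linarith
    then show ?thesis
      by (intro image_eqI[where x = "\<lfloor>y / w\<rfloor>"]) auto
  qed
  with int have "S = range (\<lambda>k::int. of_int k * w)" by auto
  with w(2) that show thesis by blast
qed

lemma conj_transl_closed [simp]: "B \<in> carrier PSL2R \<Longrightarrow> conj_transl B x \<in> carrier PSL2R"
  by (simp add: conj_transl_def)

lemma conj_transl_0 [simp]: "B \<in> carrier PSL2R \<Longrightarrow> conj_transl B 0 = \<one>\<^bsub>PSL2R\<^esub>"
  by (simp add: conj_transl_def)

lemma PSL2R_conj_mult: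
  assumes "B \<in> carrier PSL2R" "X \<in> carrier PSL2R" "Y \<in> carrier PSL2R"
  shows "(B \<otimes>\<^bsub>PSL2R\<^esub> X \<otimes>\<^bsub>PSL2R\<^esub> inv\<^bsub>PSL2R\<^esub> B) \<otimes>\<^bsub>PSL2R\<^esub> (B \<otimes>\<^bsub>PSL2R\<^esub> Y \<otimes>\<^bsub>PSL2R\<^esub> inv\<^bsub>PSL2R\<^esub> B)
    = B \<otimes>\<^bsub>PSL2R\<^esub> (X \<otimes>\<^bsub>PSL2R\<^esub> Y) \<otimes>\<^bsub>PSL2R\<^esub> inv\<^bsub>PSL2R\<^esub> B"
  using assms by (simp add: PSL2R.m_assoc)

lemma conj_transl_add:
  "B \<in> carrier PSL2R \<Longrightarrow> conj_transl B (x + y) = conj_transl B x \<otimes>\<^bsub>PSL2R\<^esub> conj_transl B y"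
  by (simp add: conj_transl_def PSL2R_conj_mult transl_add)

lemma conj_transl_minus:
  "B \<in> carrier PSL2R \<Longrightarrow> conj_transl B (- x) = inv\<^bsub>PSL2R\<^esub> conj_transl B x"
  using conj_transl_add[of B "- x" x] PSL2R.inv_equality by simp

lemma conj_transl_nat_mult:
  "B \<in> carrier PSL2R \<Longrightarrow> conj_transl B (of_nat n * x) = conj_transl B x [^]\<^bsub>PSL2R\<^esub> n"
  by (induction n) (simp_all add: distrib_right conj_transl_add add.commute[of x])

lemma conj_transl_int_mult:
  assumes "B \<in> carrier PSL2R"
  shows "conj_transl B (of_int k * x) = conj_transl B x [^]\<^bsub>PSL2R\<^esub> k"
proof (cases k rule: int_cases2)
  case (nonneg n)
  with assms show ?thesis by (simp add: conj_transl_nat_mult int_pow_int)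
next
  case (nonpos n)
  with assms show ?thesis
    by (simp add: conj_transl_nat_mult conj_transl_minus PSL2R.int_pow_neg int_pow_int)
qed

lemma conj_transl_mult:
  assumes "X \<in> carrier PSL2R" "B \<in> carrier PSL2R"
  shows "conj_transl (X \<otimes>\<^bsub>PSL2R\<^esub> B) x = X \<otimes>\<^bsub>PSL2R\<^esub> conj_transl B x \<otimes>\<^bsub>PSL2R\<^esub> inv\<^bsub>PSL2R\<^esub> X"
  using assms by (simp add: conj_transl_def PSL2R.m_assoc PSL2R.inv_mult_group)

lemma conj_transl_rescale:
  assumes "B \<in> carrier PSL2R" "a \<noteq> 0"
  shows "conj_transl (B \<otimes>\<^bsub>PSL2R\<^esub> pm (mat2 a b 0 (1 / a))) x = conj_transl B (a\<^sup>2 * x)"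
  using assms conj_transl_fixing_Infty[OF assms(2)] by (simp add: conj_transl_mult) (simp add: conj_transl_def)

lemma act_conj_transl:
  assumes "B \<in> carrier PSL2R" "act_bd B Infty = p"
  shows "act_bd (conj_transl B x) p = p"
  using act_bd_inv[OF assms] assms
  by (simp add: conj_transl_def act_bd_mult) (simp add: transl_def)

definition periods :: "(real^2^2) set set \<Rightarrow> (real^2^2) set \<Rightarrow> real set" where
  "periods \<Gamma> B = {x. conj_transl B x \<in> \<Gamma>}"

lemma mem_periods [simp]: "x \<in> periods \<Gamma> B \<longleftrightarrow> conj_transl B x \<in> \<Gamma>"
  by (simp add: periods_def)

text \<open>This replaces the parabolic elements in the definition of a cusp by a condition on the subgroup
  of the line that also determines the width.\<close>

lemma is_cusp_iff_periods:
  assumes "\<Gamma> \<subseteq> carrier PSL2R" "B \<in> carrier PSL2R" "act_bd B Infty = p"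
  shows "is_cusp \<Gamma> p \<longleftrightarrow> (\<exists>x\<in>periods \<Gamma> B. x \<noteq> 0)"
proof
  assume "is_cusp \<Gamma> p"
  then obtain X where X: "X \<in> \<Gamma>" "parabolic X" "act_bd X p = p"
    by (auto simp: is_cusp_def)
  with assms(1) have X': "X \<in> carrier PSL2R" by auto
  let ?Y = "inv\<^bsub>PSL2R\<^esub> B \<otimes>\<^bsub>PSL2R\<^esub> X \<otimes>\<^bsub>PSL2R\<^esub> B"
  have "parabolic ?Y"
    using parabolic_conj[OF X(2), of "inv\<^bsub>PSL2R\<^esub> B"] assms(2) by simp
  moreover have "act_bd ?Y Infty = Infty"
    using X' X(3) assms(2,3) act_bd_inv[OF assms(2,3)] by (simp add: act_bd_mult)
  ultimately obtain y where y: "y \<noteq> 0" "?Y = transl y"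
    by (rule parabolic_fixing_Infty)
  have "conj_transl B y = X"
    unfolding conj_transl_def y(2)[symmetric]
    using X' assms(2) by (simp add: PSL2R.m_assoc)
  with X y show "\<exists>x\<in>periods \<Gamma> B. x \<noteq> 0" by auto
next
  assume "\<exists>x\<in>periods \<Gamma> B. x \<noteq> 0"
  then obtain x where x: "conj_transl B x \<in> \<Gamma>" "x \<noteq> 0" by auto
  have "parabolic (conj_transl B x)"
    unfolding conj_transl_def using parabolic_conj[OF parabolic_transl[OF x(2)] assms(2)] .
  moreover have "act_bd (conj_transl B x) p = p"
    using act_conj_transl[OF assms(2,3)] .
  ultimately show "is_cusp \<Gamma> p"
    using x by (auto simp: is_cusp_def)
qed

definition discrete_subgroup :: "(real^2^2) set set \<Rightarrow> bool" where
  "discrete_subgroup \<Gamma> \<longleftrightarrow>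
     subgroup \<Gamma> PSL2R \<and> subtopology PSL2R_topology \<Gamma> = discrete_topology \<Gamma>"

lemma discrete_subgroup_subset:
  assumes "discrete_subgroup G" "subgroup H PSL2R" "H \<subseteq> G"
  shows "discrete_subgroup H"
proof -
  have "subtopology PSL2R_topology H = subtopology (subtopology PSL2R_topology G) H"
    using assms(3) by (simp add: subtopology_subtopology inf.absorb2)
  also have "\<dots> = discrete_topology H"
    using assms(1,3) by (simp add: discrete_subgroup_def subtopology_discrete_topology inf.absorb2)
  finally show ?thesis
    using assms(2) by (simp add: discrete_subgroup_def)
qed

text \<open>The one-parameter group \<open>x \<mapsto> B t\<^sup>x B\<^sup>-\<^sup>1\<close> lifts to the affine map
  \<open>x \<mapsto> 1 + x N\<close> into matrices, with \<open>N\<close> nilpotent. Its preimage of a neighbourhood of the identity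
  that meets \<open>\<Gamma>\<close> only in the identity is an open set around 0.\<close>

lemma periods_discrete:
  assumes \<Gamma>: "discrete_subgroup \<Gamma>" and B: "B \<in> carrier PSL2R"
  obtains \<epsilon> where "\<epsilon> > 0" "\<And>x. x \<in> periods \<Gamma> B \<Longrightarrow> \<bar>x\<bar> < \<epsilon> \<Longrightarrow> x = 0"
proof -
  have "\<one>\<^bsub>PSL2R\<^esub> \<in> \<Gamma>"
    using \<Gamma> by (simp add: discrete_subgroup_def subgroup.one_closed)
  then have "openin (subtopology PSL2R_topology \<Gamma>) {\<one>\<^bsub>PSL2R\<^esub>}"
    using \<Gamma> by (simp add: discrete_subgroup_def)
  then obtain U where U: "openin PSL2R_topology U" "{\<one>\<^bsub>PSL2R\<^esub>} = U \<inter> \<Gamma>"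
    by (auto simp: openin_subtopology)
  then have "U \<subseteq> carrier PSL2R" "openin (top_of_set (carrier SL2R)) (\<Union>U)"
    by (simp_all add: PSL2R_topology_def topology_inverse'[OF istopology_PSL2R])
  then obtain T where T: "open T" "\<Union>U = carrier SL2R \<inter> T"
    by (auto simp: openin_open)
  obtain a b c d where abcd: "B = pm (mat2 a b c d)" "a * d - b * c = 1"
    using PSL2R_cases[OF B] .
  define f where "f x = mat 1 + x *\<^sub>R mat2 (- a * c) (a\<^sup>2) (- c\<^sup>2) (a * c)" for x
  have f: "f x = mat2 (1 - a * c * x) (a\<^sup>2 * x) (- c\<^sup>2 * x) (1 + a * c * x)" for x
    by (simp add: f_def vec_eq_iff forall_2 mat_def)
  have conj: "conj_transl B x = pm (f x)" for x
  proof -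
    have "mat2 a b c d ** mat2 1 x 0 1 ** mat2 d (-b) (-c) a =
      mat2 ((a * d - b * c) - a * c * x) (a\<^sup>2 * x) (- c\<^sup>2 * x) ((a * d - b * c) + a * c * x)"
      by (simp add: mat2_eq_iff power2_eq_square algebra_simps)
    then show ?thesis
      using abcd by (simp add: conj_transl_def transl_def f)
  qed
  have det: "det (f x) = 1" for x
    by (simp add: f power2_eq_square algebra_simps)
  have "open (f -` T)"
    using T(1) unfolding f_def by (intro open_vimage continuous_intros)
  moreover have "0 \<in> f -` T"
  proof -
    have "f 0 \<in> \<one>\<^bsub>PSL2R\<^esub>"
      by (simp add: f_def one_PSL2R mat_1_eq_mat2 pm_def)
    then show ?thesis using U(2) T(2) by auto
  qed
  ultimately obtain \<epsilon> where \<epsilon>: "\<epsilon> > 0" "ball 0 \<epsilon> \<subseteq> f -` T"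
    using open_contains_ball by blast
  have "x = 0" if "x \<in> periods \<Gamma> B" "\<bar>x\<bar> < \<epsilon>" for x
  proof -
    have "f x \<in> \<Union>U"
      using \<epsilon>(2) that(2) det unfolding T(2) by (auto simp: SL2R_def)
    then obtain X where "X \<in> U" "f x \<in> X" by blast
    moreover from \<open>X \<in> U\<close> obtain A where "X = pm A"
      using \<open>U \<subseteq> carrier PSL2R\<close> carrier_PSL2R by blast
    ultimately have "conj_transl B x \<in> U"
      unfolding conj by (auto simp: pm_def insert_commute)
    with that(1) U(2) have "conj_transl B x = \<one>\<^bsub>PSL2R\<^esub>" by auto
    then have "transl x = transl 0"
      using B by (simp add: conj_transl_def PSL2R.conj_eq_one_iff)
    then show ?thesis by (simp only: transl_inject)
  qed
  with \<epsilon>(1) that show thesis by blast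
qed

lemma least_positive_int_multiple:
  fixes w :: real
  assumes "w > 0" "\<And>x. P x \<longleftrightarrow> x \<in> range (\<lambda>k::int. of_int k * w)"
  shows "(LEAST x. 0 < x \<and> P x) = w"
proof (rule Least_equality)
  show "0 < w \<and> P w"
    using assms by (auto intro: image_eqI[where x = 1])
next
  fix x assume "0 < x \<and> P x"
  then obtain k :: int where k: "x = of_int k * w" "0 < x"
    using assms(2) by auto
  with assms(1) have "1 \<le> k" by (auto simp: zero_less_mult_iff)
  with k assms(1) show "w \<le> x" by simp
qed

lemma periods_eq_width_multiples:
  assumes \<Gamma>: "discrete_subgroup \<Gamma>" and B: "B \<in> carrier PSL2R"
    and "is_cusp \<Gamma> (act_bd B Infty)"
  shows "width_wrt \<Gamma> B > 0" "periods \<Gamma> B = range (\<lambda>k::int. of_int k * width_wrt \<Gamma> B)"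
proof -
  interpret \<Gamma>: subgroup \<Gamma> PSL2R
    using \<Gamma> by (simp add: discrete_subgroup_def)
  obtain s where "s \<in> periods \<Gamma> B" "s \<noteq> 0"
    using is_cusp_iff_periods[OF \<Gamma>.subset B refl] assms(3) by blast
  moreover obtain \<epsilon> where "\<epsilon> > 0" "\<And>x. x \<in> periods \<Gamma> B \<Longrightarrow> \<bar>x\<bar> < \<epsilon> \<Longrightarrow> x = 0"
    by (rule periods_discrete[OF \<Gamma> B]) blast
  moreover have "x - y \<in> periods \<Gamma> B" if "x \<in> periods \<Gamma> B" "y \<in> periods \<Gamma> B" for x y
    using that B conj_transl_add[of B x "- y"] by (simp add: conj_transl_minus)
  ultimately obtain w where w: "w > 0" "periods \<Gamma> B = range (\<lambda>k::int. of_int k * w)"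
    using real_discrete_subgroup_cyclic[of "periods \<Gamma> B"] by metis
  then have "width_wrt \<Gamma> B = w"
    unfolding width_wrt_def by (intro least_positive_int_multiple) (auto simp flip: mem_periods)
  with w show "width_wrt \<Gamma> B > 0" "periods \<Gamma> B = range (\<lambda>k::int. of_int k * width_wrt \<Gamma> B)"
    by simp_all
qed

text \<open>The least element in the definition of the width has to exist here, so the point must be a cusp of
  a discrete group.\<close>

lemma width_wrt_rescale:
  assumes \<Gamma>: "discrete_subgroup \<Gamma>" and B: "B \<in> carrier PSL2R"
    and "is_cusp \<Gamma> (act_bd B Infty)" and "a \<noteq> 0"
  shows "width_wrt \<Gamma> (B \<otimes>\<^bsub>PSL2R\<^esub> pm (mat2 a b 0 (1 / a))) = width_wrt \<Gamma> B / a\<^sup>2"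
proof -
  note w = periods_eq_width_multiples[OF assms(1-3)]
  have "conj_transl B (a\<^sup>2 * x) \<in> \<Gamma> \<longleftrightarrow> x \<in> range (\<lambda>k::int. of_int k * (width_wrt \<Gamma> B / a\<^sup>2))" for x
    unfolding mem_periods[symmetric] w(2) using \<open>a \<noteq> 0\<close> by (auto simp: image_iff field_simps)
  then show ?thesis
    using w(1) \<open>a \<noteq> 0\<close> unfolding width_wrt_def[of \<Gamma> "_ \<otimes>\<^bsub>PSL2R\<^esub> _"] conj_transl_rescale[OF B \<open>a \<noteq> 0\<close>]
    by (intro least_positive_int_multiple) auto
qed

lemma coordinates_same_cusp:
  assumes "B \<in> carrier PSL2R" "B' \<in> carrier PSL2R" "act_bd B Infty = act_bd B' Infty"
  obtains a b where "a \<noteq> 0" "B' = B \<otimes>\<^bsub>PSL2R\<^esub> pm (mat2 a b 0 (1 / a))"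
proof -
  have "act_bd (inv\<^bsub>PSL2R\<^esub> B \<otimes>\<^bsub>PSL2R\<^esub> B') Infty = Infty"
    using assms act_bd_inv[OF assms(1,3)] by (simp add: act_bd_mult)
  then obtain a b where "a \<noteq> 0" "inv\<^bsub>PSL2R\<^esub> B \<otimes>\<^bsub>PSL2R\<^esub> B' = pm (mat2 a b 0 (1 / a))"
    using assms by (metis fixes_Infty_cases PSL2R.inv_closed PSL2R.m_closed)
  moreover from this have "B' = B \<otimes>\<^bsub>PSL2R\<^esub> pm (mat2 a b 0 (1 / a))"
    using assms by (metis PSL2R.inv_solve_left PSL2R.inv_closed PSL2R.m_closed)
  ultimately show thesis using that by blast
qed

lemma width_ratio_coordinate_free:
  assumes "discrete_subgroup G" "discrete_subgroup H"
    and "B \<in> carrier PSL2R" "B' \<in> carrier PSL2R" "act_bd B Infty = act_bd B' Infty"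
    and "is_cusp G (act_bd B Infty)" "is_cusp H (act_bd B Infty)"
  shows "width_wrt H B / width_wrt G B = width_wrt H B' / width_wrt G B'"
proof -
  obtain a b where "a \<noteq> 0" "B' = B \<otimes>\<^bsub>PSL2R\<^esub> pm (mat2 a b 0 (1 / a))"
    using coordinates_same_cusp[OF assms(3-5)] .
  then show ?thesis
    using assms by (simp add: width_wrt_rescale)
qed

lemma conj_transl_mult_mem_iff:
  assumes "subgroup \<Gamma> PSL2R" "X \<in> \<Gamma>" "B \<in> carrier PSL2R"
  shows "conj_transl (X \<otimes>\<^bsub>PSL2R\<^esub> B) x \<in> \<Gamma> \<longleftrightarrow> conj_transl B x \<in> \<Gamma>"
proof -
  interpret \<Gamma>: subgroup \<Gamma> PSL2R by fact
  have X: "X \<in> carrier PSL2R" using assms(2) by simp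
  have "conj_transl B x = inv\<^bsub>PSL2R\<^esub> X \<otimes>\<^bsub>PSL2R\<^esub> conj_transl (X \<otimes>\<^bsub>PSL2R\<^esub> B) x \<otimes>\<^bsub>PSL2R\<^esub> X"
    using X assms(3) by (simp add: conj_transl_mult PSL2R.m_assoc)
  then show ?thesis
    using X assms by (metis \<Gamma>.m_closed \<Gamma>.m_inv_closed conj_transl_mult)
qed

lemma width_wrt_mult:
  assumes "subgroup \<Gamma> PSL2R" "X \<in> \<Gamma>" "B \<in> carrier PSL2R"
  shows "width_wrt \<Gamma> (X \<otimes>\<^bsub>PSL2R\<^esub> B) = width_wrt \<Gamma> B"
  by (simp add: width_wrt_def conj_transl_mult_mem_iff[OF assms])

text \<open>Let \<open>X B = B U\<close> with \<open>U\<close> fixing infinity and stretching by \<open>a\<^sup>2\<close>. Multiplying \<open>B\<close> by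
  \<open>X \<in> \<Gamma>\<close> on the left preserves the width, whereas multiplying by \<open>U\<close> on the right divides it by
  \<open>a\<^sup>2\<close>. As the width is not 0, \<open>a\<^sup>2 = 1\<close>; this excludes hyperbolic elements that fix a cusp.\<close>

lemma stabilizer_consists_of_translations:
  assumes \<Gamma>: "discrete_subgroup \<Gamma>" and B: "B \<in> carrier PSL2R"
    and cusp: "is_cusp \<Gamma> (act_bd B Infty)"
    and X: "X \<in> \<Gamma>" "act_bd X (act_bd B Infty) = act_bd B Infty"
  obtains k :: int where "X = conj_transl B (width_wrt \<Gamma> B) [^]\<^bsub>PSL2R\<^esub> k"
proof -
  interpret \<Gamma>: subgroup \<Gamma> PSL2R
    using \<Gamma> by (simp add: discrete_subgroup_def)
  note w = periods_eq_width_multiples[OF \<Gamma> B cusp]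
  let ?w = "width_wrt \<Gamma> B"
  have X': "X \<in> carrier PSL2R" using X(1) by simp
  obtain a b where a: "a \<noteq> 0" "X \<otimes>\<^bsub>PSL2R\<^esub> B = B \<otimes>\<^bsub>PSL2R\<^esub> pm (mat2 a b 0 (1 / a))"
    using coordinates_same_cusp[of B "X \<otimes>\<^bsub>PSL2R\<^esub> B"] X' B X(2) by (auto simp: act_bd_mult)
  have "?w / a\<^sup>2 = ?w"
    using width_wrt_rescale[OF \<Gamma> B cusp a(1), of b] width_wrt_mult[OF _ X(1) B]
    by (simp add: a(2) \<Gamma>.subgroup_axioms)
  with w(1) a(1) have "a\<^sup>2 = 1"
    by (simp add: field_simps)
  then obtain y where y: "pm (mat2 a b 0 (1 / a)) = transl y"
    by (rule transl_if_square_eq_1)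
  have "X = conj_transl B y"
    unfolding conj_transl_def y[symmetric] a(2)[symmetric] using X' B by (simp add: PSL2R.m_assoc)
  moreover from this X(1) obtain k :: int where "y = of_int k * ?w"
    using w(2) mem_periods by blast
  ultimately show thesis
    using that B by (simp add: conj_transl_int_mult)
qed

section \<open>Cosets and cyclic double cosets\<close>

lemma (in group) l_coset_eq_iff:
  assumes "subgroup H G" "x \<in> carrier G" "y \<in> carrier G"
  shows "x <# H = y <# H \<longleftrightarrow> inv x \<otimes> y \<in> H"
proof -
  interpret subgroup H G by fact
  have "x <# H = y <# H \<longleftrightarrow> y \<in> x <# H"
    using assms lcos_self l_repr_independence by blast
  also have "\<dots> \<longleftrightarrow> inv x \<otimes> y \<in> H"
  proof
    show "inv x \<otimes> y \<in> H" if "y \<in> x <# H"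
      using lcos_module_imp[OF is_group assms(2) that] .
    show "y \<in> x <# H" if "inv x \<otimes> y \<in> H"
      using that assms by (auto simp: l_coset_def intro!: bexI[of _ "inv x \<otimes> y"])
  qed
  finally show ?thesis .
qed

text \<open>By the pigeonhole principle two powers of \<open>x\<close> lie in the same coset.\<close>

lemma (in group) power_mem_finite_index_subgroup:
  assumes H: "subgroup H G" and fin: "finite (lcosets H)" and x: "x \<in> carrier G"
  obtains N :: nat where "N > 0" "x [^] N \<in> H"
proof -
  have "range (\<lambda>k::nat. x [^] k <# H) \<subseteq> lcosets H"
    using x by (auto simp: LCOSETS_def)
  with fin have "\<not> inj (\<lambda>k::nat. x [^] k <# H)"
    using finite_imageD finite_subset infinite_UNIV_nat by blast
  then obtain k l :: nat where "k < l" "x [^] k <# H = x [^] l <# H"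
    by (metis (mono_tags, lifting) injI nat_neq_iff)
  then have "inv (x [^] k) \<otimes> x [^] l \<in> H"
    using H x by (simp add: l_coset_eq_iff)
  moreover have "x [^] l = x [^] k \<otimes> x [^] (l - k)"
    using x \<open>k < l\<close> by (simp add: nat_pow_mult)
  ultimately have "x [^] (l - k) \<in> H"
    using x by simp
  with \<open>k < l\<close> that[of "l - k"] show thesis by simp
qed

text \<open>The hypotheses say that \<open>G\<close> is the disjoint union of the double cosets \<open>H a\<^sub>i \<langle>t\<rangle>\<close> and that \<open>d\<^sub>i\<close> is the
  index of \<open>\<langle>t\<rangle> \<inter> a\<^sub>i\<^sup>-\<^sup>1 H a\<^sub>i\<close> in \<open>\<langle>t\<rangle>\<close>. Since
  \<open>(t\<^sup>k a\<^sub>i\<^sup>-\<^sup>1)\<^sup>-\<^sup>1 (t\<^sup>l a\<^sub>j\<^sup>-\<^sup>1) = a\<^sub>i t\<^sup>l\<^sup>-\<^sup>k a\<^sub>j\<^sup>-\<^sup>1\<close>, the cosets of \<open>t\<^sup>k a\<^sub>i\<^sup>-\<^sup>1\<close> and \<open>t\<^sup>l a\<^sub>j\<^sup>-\<^sup>1\<close> agree iff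
  \<open>i = j\<close> and \<open>k\<close>, \<open>l\<close> are congruent modulo \<open>d\<^sub>i\<close>.\<close>

lemma (in group) lcosets_of_cyclic_double_cosets:
  fixes d :: "'i \<Rightarrow> nat"
  assumes H: "subgroup H G" and t: "t \<in> carrier G"
    and a: "\<And>i. i \<in> I \<Longrightarrow> a i \<in> carrier G"
    and cover: "\<And>g. g \<in> carrier G \<Longrightarrow> \<exists>i\<in>I. \<exists>h\<in>H. \<exists>k::int. g = h \<otimes> a i \<otimes> t [^] k"
    and disjoint: "\<And>i j k. i \<in> I \<Longrightarrow> j \<in> I \<Longrightarrow> a i \<otimes> t [^] (k::int) \<otimes> inv (a j) \<in> H \<Longrightarrow> i = j"
    and d_pos: "\<And>i. i \<in> I \<Longrightarrow> d i > 0"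
    and d: "\<And>i k. i \<in> I \<Longrightarrow> a i \<otimes> t [^] (k::int) \<otimes> inv (a i) \<in> H \<longleftrightarrow> int (d i) dvd k"
  shows "bij_betw (\<lambda>(i, j :: nat). (t [^] j \<otimes> inv (a i)) <# H) (SIGMA i:I. {..<d i}) (lcosets H)"
proof -
  interpret subgroup H G by fact
  have eq_iff: "(t [^] k \<otimes> inv (a i)) <# H = (t [^] l \<otimes> inv (a j)) <# H \<longleftrightarrow>
      i = j \<and> int (d i) dvd l - k" if "i \<in> I" "j \<in> I" for i j and k l :: int
  proof -
    have "inv (t [^] k \<otimes> inv (a i)) \<otimes> (t [^] l \<otimes> inv (a j))
        = a i \<otimes> (t [^] (- k) \<otimes> t [^] l) \<otimes> inv (a j)"
      using that a t by (simp add: inv_mult_group m_assoc int_pow_neg)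
    also have "t [^] (- k) \<otimes> t [^] l = t [^] (l - k)"
      using int_pow_mult[OF t, of "- k" l] by simp
    finally have "(t [^] k \<otimes> inv (a i)) <# H = (t [^] l \<otimes> inv (a j)) <# H \<longleftrightarrow>
        a i \<otimes> t [^] (l - k) \<otimes> inv (a j) \<in> H"
      using that a t H by (simp add: l_coset_eq_iff)
    then show ?thesis
      using that d disjoint by metis
  qed
  show ?thesis
  proof (rule bij_betw_imageI)
    show "inj_on (\<lambda>(i, j). (t [^] j \<otimes> inv (a i)) <# H) (SIGMA i:I. {..<d i})"
    proof (rule inj_onI)
      fix p q
      assume "p \<in> (SIGMA i:I. {..<d i})" "q \<in> (SIGMA i:I. {..<d i})"
        and "(\<lambda>(i, j). (t [^] j \<otimes> inv (a i)) <# H) p = (\<lambda>(i, j). (t [^] j \<otimes> inv (a i)) <# H) q"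
      moreover obtain i k j l where pq: "p = (i, k)" "q = (j, l)"
        by (metis surj_pair)
      ultimately have kl: "i \<in> I" "j \<in> I" "k < d i" "l < d j"
        and "(t [^] k \<otimes> inv (a i)) <# H = (t [^] l \<otimes> inv (a j)) <# H"
        by simp_all
      then have "i = j \<and> int (d i) dvd int l - int k"
        by (intro eq_iff[THEN iffD1]) (simp_all add: int_pow_int)
      then have ij: "i = j" "int (d i) dvd int l - int k"
        by blast+
      then have "int l mod int (d i) = int k mod int (d i)"
        by (simp add: mod_eq_dvd_iff)
      with ij(1) kl have "k = l" by simp
      with ij(1) pq show "p = q" by simp
    qed
  next
    have "(t [^] k \<otimes> inv (a i)) <# H \<in> lcosets H" if "i \<in> I" for i and k :: nat
      using that a t by (auto simp: LCOSETS_def)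
    moreover have "\<exists>i\<in>I. \<exists>j\<in>{..<d i}. g <# H = (t [^] j \<otimes> inv (a i)) <# H" if "g \<in> carrier G" for g
    proof -
      \<comment> \<open>The double cosets are written with \<open>H\<close> on the left, the cosets with \<open>H\<close> on the right.\<close>
      obtain i h k where i: "i \<in> I" "h \<in> H" "inv g = h \<otimes> a i \<otimes> t [^] (k::int)"
        using cover[OF inv_closed[OF \<open>g \<in> carrier G\<close>]] by blast
      define j where "j = nat ((- k) mod int (d i))"
      have j: "int j = (- k) mod int (d i)"
        unfolding j_def using d_pos[OF i(1)] by simp
      then have "j < d i"
        using d_pos[OF i(1)] by (metis of_nat_less_iff pos_mod_bound of_nat_0_less_iff)
      have "g = inv (h \<otimes> a i \<otimes> t [^] k)"
        using i(3) that by (metis inv_inv)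
      then have "inv g \<otimes> (t [^] (- k) \<otimes> inv (a i)) = h"
        using i a t by (simp add: m_assoc int_pow_neg)
      then have "g <# H = (t [^] (- k) \<otimes> inv (a i)) <# H"
        using i a t that H by (simp add: l_coset_eq_iff)
      also have "\<dots> = (t [^] int j \<otimes> inv (a i)) <# H"
      proof -
        have "int (d i) dvd int j - (- k)"
          by (metis j mod_eq_dvd_iff mod_mod_trivial)
        then show ?thesis
          using i(1) eq_iff by blast
      qed
      finally show ?thesis
        using \<open>j < d i\<close> i(1) by (auto simp: int_pow_int)
    qed
    ultimately show "(\<lambda>(i, j). (t [^] j \<otimes> inv (a i)) <# H) ` (SIGMA i:I. {..<d i}) = lcosets H"
      by (auto simp: LCOSETS_def image_iff)
  qed
qed

section \<open>Cusps of a finite index subgroup\<close>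

lemma is_cusp_mono: "H \<subseteq> G \<Longrightarrow> is_cusp H p \<Longrightarrow> is_cusp G p"
  by (auto simp: is_cusp_def)

lemma is_cusp_act:
  assumes "subgroup \<Gamma> PSL2R" "g \<in> \<Gamma>" "is_cusp \<Gamma> p"
  shows "is_cusp \<Gamma> (act_bd g p)"
proof -
  interpret \<Gamma>: subgroup \<Gamma> PSL2R by fact
  have g: "g \<in> carrier PSL2R" using assms(2) by simp
  obtain x where "x \<in> periods \<Gamma> (cusp_mat p)" "x \<noteq> 0"
    using is_cusp_iff_periods[OF \<Gamma>.subset cusp_mat_closed act_cusp_mat] assms(3) by blast
  then have "x \<in> periods \<Gamma> (g \<otimes>\<^bsub>PSL2R\<^esub> cusp_mat p)" "x \<noteq> 0"
    using conj_transl_mult_mem_iff[OF assms(1,2)] by simp_all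
  moreover have "g \<otimes>\<^bsub>PSL2R\<^esub> cusp_mat p \<in> carrier PSL2R"
    "act_bd (g \<otimes>\<^bsub>PSL2R\<^esub> cusp_mat p) Infty = act_bd g p"
    using g by (simp_all add: act_bd_mult)
  ultimately show ?thesis
    using is_cusp_iff_periods[OF \<Gamma>.subset] by blast
qed

text \<open>The two groups of periods are nested infinite cyclic groups, and \<open>d\<close> is the index.\<close>

lemma width_in_subgroup:
  assumes G: "discrete_subgroup G" and H: "discrete_subgroup H" "H \<subseteq> G"
    and B: "B \<in> carrier PSL2R" and cusp: "is_cusp H (act_bd B Infty)"
  obtains d :: nat where "d > 0" "width_wrt H B = real d * width_wrt G B"
    "\<And>k::int. conj_transl B (width_wrt G B) [^]\<^bsub>PSL2R\<^esub> k \<in> H \<longleftrightarrow> int d dvd k"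
proof -
  let ?w = "width_wrt G B" and ?v = "width_wrt H B"
  note w = periods_eq_width_multiples[OF G B is_cusp_mono[OF H(2) cusp]]
  note v = periods_eq_width_multiples[OF H(1) B cusp]
  have "?v \<in> periods H B"
    unfolding v(2) by (auto intro: image_eqI[where x = 1])
  then have "?v \<in> periods G B"
    using H(2) by auto
  then obtain e :: int where e: "?v = of_int e * ?w"
    unfolding w(2) by auto
  with w(1) v(1) have "e > 0"
    by (auto simp: zero_less_mult_iff)
  have "conj_transl B ?w [^]\<^bsub>PSL2R\<^esub> k \<in> H \<longleftrightarrow> e dvd k" for k :: int
  proof -
    have "conj_transl B ?w [^]\<^bsub>PSL2R\<^esub> k \<in> H \<longleftrightarrow> of_int k * ?w \<in> periods H B"
      using B by (simp add: conj_transl_int_mult)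
    also have "\<dots> \<longleftrightarrow> (\<exists>l::int. of_int k * ?w = of_int (e * l) * ?w)"
      unfolding v(2) e by (auto simp: image_iff mult_ac)
    also have "\<dots> \<longleftrightarrow> e dvd k"
      using w(1) by (auto simp: dvd_def simp del: of_int_mult)
    finally show ?thesis .
  qed
  with e \<open>e > 0\<close> that[of "nat e"] show thesis by simp
qed

text \<open>A power of \<open>B t\<^sup>x B\<^sup>-\<^sup>1\<close> with \<open>x \<noteq> 0\<close> that lies in \<open>H\<close> is again parabolic, because its
  exponent \<open>N x\<close> is not 0.\<close>

lemma is_cusp_finite_index:
  assumes G: "subgroup G PSL2R" and H: "subgroup H (PSL2R\<lparr>carrier := G\<rparr>)"
    and fin: "finite (lcosets\<^bsub>PSL2R\<lparr>carrier := G\<rparr>\<^esub> H)" and cusp: "is_cusp G p"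
  shows "is_cusp H p"
proof -
  interpret \<Gamma>: group "PSL2R\<lparr>carrier := G\<rparr>"
    using PSL2R.subgroup_imp_group[OF G] .
  have H': "subgroup H PSL2R"
    using PSL2R.incl_subgroup[OF G H] .
  let ?B = "cusp_mat p"
  obtain x where x: "conj_transl ?B x \<in> G" "x \<noteq> 0"
    using is_cusp_iff_periods[OF subgroup.subset[OF G] cusp_mat_closed act_cusp_mat] cusp by auto
  obtain N :: nat where "N > 0" "conj_transl ?B x [^]\<^bsub>PSL2R\<^esub> N \<in> H"
    using \<Gamma>.power_mem_finite_index_subgroup[OF H fin] x(1)
    by (auto simp flip: PSL2R.nat_pow_consistent)
  then have "of_nat N * x \<in> periods H ?B" "of_nat N * x \<noteq> 0"
    using x(2) by (simp_all add: conj_transl_nat_mult)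
  then show ?thesis
    using is_cusp_iff_periods[OF subgroup.subset[OF H'] cusp_mat_closed act_cusp_mat] by blast
qed

lemma mem_orbit_bd: "q \<in> orbit_bd \<Gamma> p \<longleftrightarrow> (\<exists>g\<in>\<Gamma>. q = act_bd g p)"
  by (auto simp: orbit_def)

lemma stabilizer_bd_eq_generate_cusp_gen:
  assumes \<Gamma>: "discrete_subgroup \<Gamma>" and cusp: "is_cusp \<Gamma> p"
  shows "stabilizer_bd \<Gamma> p = generate PSL2R {cusp_gen \<Gamma> p}"
proof -
  interpret \<Gamma>: subgroup \<Gamma> PSL2R
    using \<Gamma> by (simp add: discrete_subgroup_def)
  let ?B = "cusp_mat p" and ?t = "cusp_gen \<Gamma> p"
  have t: "?t \<in> carrier PSL2R"
    by (simp add: cusp_gen_def)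
  have pow: "conj_transl ?B (of_int k * cusp_width \<Gamma> p) = ?t [^]\<^bsub>PSL2R\<^esub> k" for k :: int
    by (simp add: cusp_gen_def conj_transl_int_mult)
  have "stabilizer_bd \<Gamma> p = range (\<lambda>k::int. ?t [^]\<^bsub>PSL2R\<^esub> k)"
  proof (intro equalityI subsetI)
    fix X assume "X \<in> stabilizer_bd \<Gamma> p"
    then show "X \<in> range (\<lambda>k::int. ?t [^]\<^bsub>PSL2R\<^esub> k)"
      using stabilizer_consists_of_translations[OF \<Gamma> cusp_mat_closed, of p X] cusp
      by (auto simp: stabilizer_def cusp_gen_def cusp_width_def)
  next
    fix X assume "X \<in> range (\<lambda>k::int. ?t [^]\<^bsub>PSL2R\<^esub> k)"
    then obtain k :: int where X: "X = conj_transl ?B (of_int k * cusp_width \<Gamma> p)"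
      by (auto simp: pow)
    have "of_int k * cusp_width \<Gamma> p \<in> periods \<Gamma> ?B"
      using periods_eq_width_multiples(2)[OF \<Gamma> cusp_mat_closed, of p] cusp
      by (auto simp: cusp_width_def simp del: mem_periods)
    then show "X \<in> stabilizer_bd \<Gamma> p"
      by (simp add: stabilizer_def X act_conj_transl)
  qed
  then show ?thesis
    using t by (auto simp: PSL2R.generate_pow)
qed

theorem lemma4p5:
  fixes G H :: "(real^2^2) set set"
    and \<cc> :: boundary_point
    and \<cc>s :: "nat \<Rightarrow> boundary_point"
    and A :: "nat \<Rightarrow> (real^2^2) set"
    and h :: "nat \<Rightarrow> real"
    and m n :: nat
  assumes "fuchsian_first_kind G"
    and "is_cusp G Infty"
    and "subgroup H (PSL2R\<lparr>carrier := G\<rparr>)"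
    and "finite (lcosets\<^bsub>PSL2R\<lparr>carrier := G\<rparr>\<^esub> H)"
    and "card (lcosets\<^bsub>PSL2R\<lparr>carrier := G\<rparr>\<^esub> H) = m"
    and "is_cusp G \<cc>"
    and "\<And>i. i \<in> {1..n} \<Longrightarrow> is_cusp H (\<cc>s i) \<and> \<cc>s i \<in> orbit_bd G \<cc>"
    and "\<And>i j. i \<in> {1..n} \<Longrightarrow> j \<in> {1..n} \<Longrightarrow> \<cc>s i \<in> orbit_bd H (\<cc>s j) \<Longrightarrow> i = j"
    and "\<And>p. is_cusp H p \<Longrightarrow> p \<in> orbit_bd G \<cc> \<Longrightarrow> \<exists>i\<in>{1..n}. p \<in> orbit_bd H (\<cc>s i)"
    and "\<And>i. i \<in> {1..n} \<Longrightarrow> A i \<in> G \<and> act_bd (A i) \<cc> = \<cc>s i"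
    and "\<And>i. i \<in> {1..n} \<Longrightarrow>
           h i = cusp_width H (\<cc>s i) / cusp_width G (\<cc>s i)"
  shows "orbit_bd G \<cc> = (\<Union>i\<in>{1..n}. orbit_bd H (\<cc>s i)) \<and>
    stabilizer_bd G \<cc> = generate PSL2R {cusp_gen G \<cc>} \<and>
    (\<forall>i\<in>{1..n}. h i = width_wrt H (A i \<otimes>\<^bsub>PSL2R\<^esub> cusp_mat \<cc>) / cusp_width G \<cc> \<and> h i \<in> \<int>) \<and>
    real m = (\<Sum>i = 1..n. h i) \<and>
    bij_betw
      (\<lambda>(i, j). (cusp_gen G \<cc> [^]\<^bsub>PSL2R\<^esub> j \<otimes>\<^bsub>PSL2R\<^esub> inv\<^bsub>PSL2R\<^esub> (A i)) <#\<^bsub>PSL2R\<^esub> H)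
      {(i, j :: nat). i \<in> {1..n} \<and> real j < h i}
      (lcosets\<^bsub>PSL2R\<lparr>carrier := G\<rparr>\<^esub> H)"
proof -
  let ?L = "PSL2R\<lparr>carrier := G\<rparr>" and ?B = "cusp_mat \<cc>" and ?t = "cusp_gen G \<cc>"
  note cs = assms(7) and cs_inequiv = assms(8) and cs_cover = assms(9) and h_def = assms(11)
  have G: "discrete_subgroup G" "subgroup G PSL2R"
    using assms(1) by (simp_all add: fuchsian_first_kind_def discrete_subgroup_def)
  interpret G: subgroup G PSL2R by (rule G(2))
  interpret L: group ?L
    using PSL2R.subgroup_imp_group[OF G(2)] .
  have H': "subgroup H PSL2R"
    using PSL2R.incl_subgroup[OF G(2) assms(3)] .
  interpret H: subgroup H PSL2R by (rule H')
  have HG: "H \<subseteq> G"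
    using subgroup.subset[OF assms(3)] by simp
  have H: "discrete_subgroup H"
    using discrete_subgroup_subset[OF G(1) H' HG] .
  have A: "A i \<in> G" "A i \<in> carrier PSL2R" "act_bd (A i) \<cc> = \<cc>s i" if "i \<in> {1..n}" for i
    using assms(10)[OF that] by simp_all

  have stab: "stabilizer_bd G \<cc> = generate PSL2R {?t}"
    using stabilizer_bd_eq_generate_cusp_gen[OF G(1) assms(6)] .
  have t': "?t \<in> carrier PSL2R"
    by (simp add: cusp_gen_def)
  have stab_iff: "X \<in> G \<and> act_bd X \<cc> = \<cc> \<longleftrightarrow> (\<exists>k::int. X = ?t [^]\<^bsub>PSL2R\<^esub> k)" for X
    using stab t' by (auto simp: stabilizer_def PSL2R.generate_pow set_eq_iff)
  have tk: "?t [^]\<^bsub>PSL2R\<^esub> (k::int) \<in> G" "act_bd (?t [^]\<^bsub>PSL2R\<^esub> k) \<cc> = \<cc>" for k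
    using stab_iff by blast+
  have t: "?t \<in> G"
    using tk(1)[of 1] t' by simp
  have int_pow: "?t [^]\<^bsub>?L\<^esub> k = ?t [^]\<^bsub>PSL2R\<^esub> k" for k :: int
    using PSL2R.int_pow_consistent[OF G(2) t] by simp

  have cover: "\<exists>i\<in>{1..n}. \<exists>x\<in>H. act_bd g \<cc> = act_bd x (\<cc>s i)" if "g \<in> G" for g
  proof -
    have "is_cusp G (act_bd g \<cc>)"
      using is_cusp_act[OF G(2) that assms(6)] .
    then have "is_cusp H (act_bd g \<cc>)"
      using is_cusp_finite_index[OF G(2) assms(3,4)] by simp
    with cs_cover[of "act_bd g \<cc>"] that show ?thesis
      by (auto simp: mem_orbit_bd)
  qed

  have orbits: "orbit_bd G \<cc> = (\<Union>i\<in>{1..n}. orbit_bd H (\<cc>s i))"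
  proof (intro equalityI subsetI)
    fix p assume "p \<in> orbit_bd G \<cc>"
    then show "p \<in> (\<Union>i\<in>{1..n}. orbit_bd H (\<cc>s i))"
      using cover unfolding UN_iff mem_orbit_bd by blast
  next
    fix p assume "p \<in> (\<Union>i\<in>{1..n}. orbit_bd H (\<cc>s i))"
    then obtain i x where i: "i \<in> {1..n}" "x \<in> H" "p = act_bd x (\<cc>s i)"
      unfolding UN_iff mem_orbit_bd by blast
    then have "p = act_bd (x \<otimes>\<^bsub>PSL2R\<^esub> A i) \<cc>" "x \<otimes>\<^bsub>PSL2R\<^esub> A i \<in> G"
      using A HG by (auto simp: act_bd_mult)
    then show "p \<in> orbit_bd G \<cc>"
      unfolding mem_orbit_bd by blast
  qed

  \<comment> \<open>The width in \<open>H\<close> is given in the coordinate \<open>cusp_mat (\<cc>s i)\<close>, but the index is read off in the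
    coordinate \<open>A i \<otimes> cusp_mat \<cc>\<close>, in which \<open>G\<close> has the same periods at \<open>\<cc>s i\<close> as at \<open>\<cc>\<close>.\<close>
  have "\<exists>d>0. h i = width_wrt H (A i \<otimes>\<^bsub>PSL2R\<^esub> ?B) / cusp_width G \<cc> \<and> h i = real d \<and>
    (\<forall>k::int. A i \<otimes>\<^bsub>PSL2R\<^esub> ?t [^]\<^bsub>PSL2R\<^esub> k \<otimes>\<^bsub>PSL2R\<^esub> inv\<^bsub>PSL2R\<^esub> (A i) \<in> H \<longleftrightarrow> int d dvd k)"
    if i: "i \<in> {1..n}" for i
  proof -
    let ?B' = "A i \<otimes>\<^bsub>PSL2R\<^esub> ?B"
    have B': "?B' \<in> carrier PSL2R" "act_bd ?B' Infty = \<cc>s i"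
      using A[OF i] by (simp_all add: act_bd_mult)
    have cusps: "is_cusp H (\<cc>s i)" "is_cusp G (\<cc>s i)"
      using cs[OF i] is_cusp_mono[OF HG] by auto
    have width: "width_wrt G ?B' = cusp_width G \<cc>"
      using width_wrt_mult[OF G(2) A(1)[OF i]] by (simp add: cusp_width_def)
    have pos: "cusp_width G \<cc> > 0"
      using periods_eq_width_multiples(1)[OF G(1) cusp_mat_closed] assms(6)
      by (simp add: cusp_width_def)
    obtain d :: nat where d: "d > 0" "width_wrt H ?B' = real d * width_wrt G ?B'"
      "\<And>k::int. conj_transl ?B' (width_wrt G ?B') [^]\<^bsub>PSL2R\<^esub> k \<in> H \<longleftrightarrow> int d dvd k"
      using width_in_subgroup[OF G(1) H HG B'(1)] cusps(1) B'(2) by auto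
    have "h i = width_wrt H ?B' / width_wrt G ?B'"
      using width_ratio_coordinate_free[OF G(1) H cusp_mat_closed B'(1), of "\<cc>s i"] cusps B'(2)
      by (simp add: h_def[OF i] cusp_width_def)
    moreover have "conj_transl ?B' (width_wrt G ?B') [^]\<^bsub>PSL2R\<^esub> k =
        A i \<otimes>\<^bsub>PSL2R\<^esub> ?t [^]\<^bsub>PSL2R\<^esub> k \<otimes>\<^bsub>PSL2R\<^esub> inv\<^bsub>PSL2R\<^esub> (A i)" for k :: int
      using A(2)[OF i]
      unfolding width cusp_gen_def conj_transl_int_mult[OF B'(1), symmetric]
        conj_transl_int_mult[OF cusp_mat_closed, symmetric]
      by (simp add: conj_transl_mult)
    ultimately show ?thesis
      using d width pos by auto
  qed
  then obtain d where d_pos: "\<And>i. i \<in> {1..n} \<Longrightarrow> d i > 0"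
    and hw: "\<And>i. i \<in> {1..n} \<Longrightarrow> h i = width_wrt H (A i \<otimes>\<^bsub>PSL2R\<^esub> ?B) / cusp_width G \<cc>"
    and hd: "\<And>i. i \<in> {1..n} \<Longrightarrow> h i = real (d i)"
    and d: "\<And>i k. i \<in> {1..n} \<Longrightarrow>
      A i \<otimes>\<^bsub>PSL2R\<^esub> ?t [^]\<^bsub>PSL2R\<^esub> (k::int) \<otimes>\<^bsub>PSL2R\<^esub> inv\<^bsub>PSL2R\<^esub> (A i) \<in> H \<longleftrightarrow> int (d i) dvd k"
    by metis

  have pairs: "{(i, j :: nat). i \<in> {1..n} \<and> real j < h i} = (SIGMA i:{1..n}. {..<d i})"
    using hd by auto
  have "bij_betw (\<lambda>(i, j :: nat). (?t [^]\<^bsub>?L\<^esub> j \<otimes>\<^bsub>?L\<^esub> inv\<^bsub>?L\<^esub> (A i)) <#\<^bsub>?L\<^esub> H)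
      (SIGMA i:{1..n}. {..<d i}) (lcosets\<^bsub>?L\<^esub> H)"
  proof (rule L.lcosets_of_cyclic_double_cosets[OF assms(3)])
    fix g assume "g \<in> carrier ?L"
    then have g: "g \<in> G" "g \<in> carrier PSL2R" by simp_all
    then obtain i x where i: "i \<in> {1..n}" "x \<in> H" "act_bd g \<cc> = act_bd x (\<cc>s i)"
      using cover by blast
    \<comment> \<open>\<open>g\<close> and \<open>?y\<close> move \<open>\<cc>\<close> to the same point, so they differ by a power of the generator.\<close>
    let ?y = "x \<otimes>\<^bsub>PSL2R\<^esub> A i"
    have y: "?y \<in> G" "?y \<in> carrier PSL2R" "act_bd ?y \<cc> = act_bd g \<cc>"
      using A[OF i(1)] i HG by (auto simp: act_bd_mult)
    have "act_bd (inv\<^bsub>PSL2R\<^esub> ?y \<otimes>\<^bsub>PSL2R\<^esub> g) \<cc> = \<cc>"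
      using y(2) g(2) act_bd_inv[OF y(2,3)] by (simp add: act_bd_mult del: PSL2R.inv_mult_group)
    moreover have "inv\<^bsub>PSL2R\<^esub> ?y \<otimes>\<^bsub>PSL2R\<^esub> g \<in> G"
      using y(1) g(1) by blast
    ultimately obtain k :: int where "inv\<^bsub>PSL2R\<^esub> ?y \<otimes>\<^bsub>PSL2R\<^esub> g = ?t [^]\<^bsub>PSL2R\<^esub> k"
      using stab_iff by blast
    then have "g = ?y \<otimes>\<^bsub>PSL2R\<^esub> ?t [^]\<^bsub>PSL2R\<^esub> k"
      using y(2) g(2) by (metis PSL2R.inv_mult_cancel(2))
    then show "\<exists>i\<in>{1..n}. \<exists>x\<in>H. \<exists>k::int. g = x \<otimes>\<^bsub>?L\<^esub> A i \<otimes>\<^bsub>?L\<^esub> ?t [^]\<^bsub>?L\<^esub> k"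
      by (intro bexI[OF _ i(1)] bexI[OF _ i(2)] exI[of _ k]) (simp add: int_pow)
  next
    fix i j and k :: int
    assume i: "i \<in> {1..n}" and j: "j \<in> {1..n}"
      and "A i \<otimes>\<^bsub>?L\<^esub> ?t [^]\<^bsub>?L\<^esub> k \<otimes>\<^bsub>?L\<^esub> inv\<^bsub>?L\<^esub> (A j) \<in> H"
    then have x: "A i \<otimes>\<^bsub>PSL2R\<^esub> ?t [^]\<^bsub>PSL2R\<^esub> k \<otimes>\<^bsub>PSL2R\<^esub> inv\<^bsub>PSL2R\<^esub> (A j) \<in> H" (is "?x \<in> H")
      using A(1) by (simp add: int_pow PSL2R.m_inv_consistent[OF G(2)])
    have "act_bd ?x (\<cc>s j) = \<cc>s i"
      using A[OF i] A[OF j] act_bd_inv[OF A(2,3)[OF j]] tk t' by (simp add: act_bd_mult)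
    with x have "\<cc>s i \<in> orbit_bd H (\<cc>s j)"
      unfolding mem_orbit_bd by metis
    with cs_inequiv[OF i j] show "i = j" .
  qed (use A t d d_pos in \<open>simp_all add: int_pow PSL2R.m_inv_consistent[OF G(2)]\<close>)
  moreover have "(?t [^]\<^bsub>?L\<^esub> j \<otimes>\<^bsub>?L\<^esub> inv\<^bsub>?L\<^esub> (A i)) <#\<^bsub>?L\<^esub> H =
      (?t [^]\<^bsub>PSL2R\<^esub> j \<otimes>\<^bsub>PSL2R\<^esub> inv\<^bsub>PSL2R\<^esub> (A i)) <#\<^bsub>PSL2R\<^esub> H" if "i \<in> {1..n}" for i and j :: nat
    using A[OF that] by (simp add: l_coset_def PSL2R.m_inv_consistent[OF G(2)] flip: PSL2R.nat_pow_consistent)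
  ultimately have bij: "bij_betw
      (\<lambda>(i, j). (?t [^]\<^bsub>PSL2R\<^esub> j \<otimes>\<^bsub>PSL2R\<^esub> inv\<^bsub>PSL2R\<^esub> (A i)) <#\<^bsub>PSL2R\<^esub> H)
      {(i, j :: nat). i \<in> {1..n} \<and> real j < h i} (lcosets\<^bsub>?L\<^esub> H)"
    unfolding pairs by (subst bij_betw_cong[symmetric]) auto
  have "m = (\<Sum>i = 1..n. d i)"
    using bij_betw_same_card[OF bij] assms(5) unfolding pairs by simp
  then have "real m = (\<Sum>i = 1..n. h i)"
    using hd by simp
  moreover have "h i \<in> \<int>" if "i \<in> {1..n}" for i
    using hd[OF that] by simp
  ultimately show ?thesis
    using orbits stab hw bij by blast
qed

end
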